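(* For any integers $k \ge 2$ and $d \ge 0$, there exists a graph $G$ with $ch_{\mathcal{S}}(G) \le k$ and $ch_{\mathcal{D}_d}(G) = k(k+1)$. In particular, for any real constant $p$, there exists a graph $G$ with $$ch(G) \ge p \cdot ch_{\mathcal{S}}(G) \ge p \cdot ch_{\mathcal{F}}(G) \ge p \cdot ch_{\mathcal{M}_2}(G).$$
   Context: Graphs are finite, simple, undirected, and have at least one vertex. Let $\mathcal{G}$ be a hereditary family of graphs (closed under taking induced subgraphs). A $\mathcal{G}$-colouring of a graph $G$ is a colouring $\phi$ of the vertices of $G$ (not required to be proper) such that each (nonempty) colour class induces a graph in $\mathcal{G}$. For a positive integer $n$, an $n$-list assignment of $G$ is a map $L$ that assigns to each vertex $v$ a set $L(v)$ of exactly $n$ colours. A $\mathcal{G}$-$L$-colouring of $G$ is a $\mathcal{G}$-colouring $\phi$ of $G$ with $\phi(v) \in L(v)$ for every vertex $v$. The graph $G$ is $\mathcal{G}$-$n$-choosable if for every $n$-list assignment $L$ of $G$ there exists a $\mathcal{G}$-$L$-colouring of $G$. The $\mathcal{G}$-choice number is $$ch_{\mathcal{G}}(G) = \min\{n : G \text{ is } \mathcal{G}\text{-}n\text{-choosable}\}.$$ The families used are: - $\mathcal{S}$, the family of star forests, i.e. graphs each of whose connected components is a star $K_{1,r}$ with $r \ge 0$ (a single vertex counts as a star); - $\mathcal{F}$, the family of forests; - $\mathcal{D}_d$, the family of graphs of maximum degree at most $d$; - $\mathcal{M}_k$, the family of graphs of maximum average degree at most $k$, where the maximum average degree of a graph is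 the maximum of $2|E(H)|/|V(H)|$ over its nonempty subgraphs $H$. The number $ch(G)$ is the usual choice number (list chromatic number) of $G$, i.e. $ch(G) = ch_{\mathcal{D}_0}(G)$. *)

theory Defs
  imports Complex_Main
begin

record 'a sgraph =
  verts :: "'a set"
  edges :: "'a set set"

definition simple_graph :: "'a sgraph \<Rightarrow> bool" where
  "simple_graph G \<longleftrightarrow> finite (verts G) \<and> verts G \<noteq> {} \<and>
     (\<forall>e\<in>edges G. e \<subseteq> verts G \<and> card e = 2)"

definition subgraph :: "'a sgraph \<Rightarrow> 'a sgraph \<Rightarrow> bool" where
  "subgraph H G \<longleftrightarrow> simple_graph H \<and> verts H \<subseteq> verts G \<and> edges H \<subseteq> edges G"

definition induced :: "'a sgraph \<Rightarrow> 'a set \<Rightarrow> 'a sgraph" where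
  "induced G W = \<lparr>verts = W, edges = {e \<in> edges G. e \<subseteq> W}\<rparr>"

definition degree :: "'a sgraph \<Rightarrow> 'a \<Rightarrow> nat" where
  "degree G v = card {e \<in> edges G. v \<in> e}"

definition max_degree :: "'a sgraph \<Rightarrow> nat" where
  "max_degree G = Max (degree G ` verts G)"

definition max_avg_degree :: "'a sgraph \<Rightarrow> real" where
  "max_avg_degree G =
     Max {2 * real (card (edges H)) / real (card (verts H)) | H. subgraph H G}"

definition components :: "'a sgraph \<Rightarrow> 'a set set" where
  "components G = (\<lambda>v. {(x, y). {x, y} \<in> edges G}\<^sup>* `` {v}) ` verts G"

text \<open>The graph is \<open>K\<^sub>1\<^sub>,\<^sub>r\<close> with centre \<open>c\<close> and \<open>r = card A\<close> leaves; \<open>A\<close> may be empty.\<close>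

definition is_star :: "'a sgraph \<Rightarrow> bool" where
  "is_star G \<longleftrightarrow> (\<exists>c A. finite A \<and> c \<notin> A \<and>
     verts G = insert c A \<and> edges G = {{c, a} | a. a \<in> A})"

definition is_cycle :: "'a sgraph \<Rightarrow> 'a list \<Rightarrow> bool" where
  "is_cycle G xs \<longleftrightarrow> 3 \<le> length xs \<and> distinct xs \<and>
     (\<forall>i < length xs. {xs ! i, xs ! (Suc i mod length xs)} \<in> edges G)"

definition star_forests :: "'a sgraph set" where
  "star_forests = {G. simple_graph G \<and> (\<forall>C\<in>components G. is_star (induced G C))}"

definition forests :: "'a sgraph set" where
  "forests = {G. simple_graph G \<and> (\<nexists>xs. is_cycle G xs)}"

definition max_degree_at_most :: "nat \<Rightarrow> 'a sgraph set" where
  "max_degree_at_most d = {G. simple_graph G \<and> max_degree G \<le> d}"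

definition mad_at_most :: "real \<Rightarrow> 'a sgraph set" where
  "mad_at_most k = {G. simple_graph G \<and> max_avg_degree G \<le> k}"

definition family_colouring :: "'a sgraph set \<Rightarrow> 'a sgraph \<Rightarrow> ('a \<Rightarrow> 'c) \<Rightarrow> bool" where
  "family_colouring \<G> G \<phi> \<longleftrightarrow>
     (\<forall>c\<in>\<phi> ` verts G. induced G {v \<in> verts G. \<phi> v = c} \<in> \<G>)"

definition proper_colouring :: "'a sgraph \<Rightarrow> ('a \<Rightarrow> 'c) \<Rightarrow> bool" where
  "proper_colouring G \<phi> \<longleftrightarrow> (\<forall>u v. {u, v} \<in> edges G \<longrightarrow> \<phi> u \<noteq> \<phi> v)"

definition list_assignment :: "nat \<Rightarrow> 'a sgraph \<Rightarrow> ('a \<Rightarrow> 'c set) \<Rightarrow> bool" where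
  "list_assignment n G L \<longleftrightarrow> (\<forall>v\<in>verts G. finite (L v) \<and> card (L v) = n)"

text \<open>Colours are natural numbers; this loses nothing, since a list assignment of a finite
  graph uses only finitely many colours.\<close>

definition family_choosable :: "'a sgraph set \<Rightarrow> nat \<Rightarrow> 'a sgraph \<Rightarrow> bool" where
  "family_choosable \<G> n G \<longleftrightarrow>
     (\<forall>L :: 'a \<Rightarrow> nat set. list_assignment n G L \<longrightarrow>
        (\<exists>\<phi>. family_colouring \<G> G \<phi> \<and> (\<forall>v\<in>verts G. \<phi> v \<in> L v)))"

definition family_choice_number :: "'a sgraph set \<Rightarrow> 'a sgraph \<Rightarrow> nat" where
  "family_choice_number \<G> G = (LEAST n. 0 < n \<and> family_choosable \<G> n G)"

definition choosable :: "nat \<Rightarrow> 'a sgraph \<Rightarrow> bool" where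
  "choosable n G \<longleftrightarrow>
     (\<forall>L :: 'a \<Rightarrow> nat set. list_assignment n G L \<longrightarrow>
        (\<exists>\<phi>. proper_colouring G \<phi> \<and> (\<forall>v\<in>verts G. \<phi> v \<in> L v)))"

definition choice_number :: "'a sgraph \<Rightarrow> nat" where
  "choice_number G = (LEAST n. 0 < n \<and> choosable n G)"

lemma simple_graph_induced:
  assumes "simple_graph G" "W \<subseteq> verts G" "W \<noteq> {}"
  shows "simple_graph (induced G W)"
  using assms by (auto simp: simple_graph_def induced_def intro: finite_subset)

lemma finite_edges:
  assumes "simple_graph G"
  shows "finite (edges G)"
  by (rule finite_subset[of _ "Pow (verts G)"]) (use assms in \<open>auto simp: simple_graph_def\<close>)

lemma max_degree_0_iff:
  assumes G: "simple_graph G"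
  shows "G \<in> max_degree_at_most 0 \<longleftrightarrow> edges G = {}"
proof -
  have f: "finite (verts G)" "verts G \<noteq> {}" using G by (auto simp: simple_graph_def)
  have "G \<in> max_degree_at_most 0 \<longleftrightarrow> (\<forall>v\<in>verts G. degree G v = 0)"
    using G f Max_le_iff[of "degree G ` verts G" 0]
    by (simp add: max_degree_at_most_def max_degree_def)
  also have "\<dots> \<longleftrightarrow> (\<forall>v\<in>verts G. \<forall>e\<in>edges G. v \<notin> e)"
    using finite_edges[OF G] by (auto simp: degree_def)
  also have "\<dots> \<longleftrightarrow> edges G = {}"
  proof
    assume h: "\<forall>v\<in>verts G. \<forall>e\<in>edges G. v \<notin> e"
    have False if "e \<in> edges G" for e
    proof -
      have "e \<subseteq> verts G" "card e = 2" using G that by (auto simp: simple_graph_def)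
      then obtain v where "v \<in> e" "v \<in> verts G" by (auto simp: card_2_iff)
      then show False using h that by blast
    qed
    then show "edges G = {}" by blast
  qed simp
  finally show ?thesis .
qed

lemma family_colouring_0_iff:
  assumes G: "simple_graph G"
  shows "family_colouring (max_degree_at_most 0) G \<phi> \<longleftrightarrow> proper_colouring G \<phi>"
proof -
  have "induced G {v \<in> verts G. \<phi> v = c} \<in> max_degree_at_most 0 \<longleftrightarrow>
      (\<nexists>e. e \<in> edges G \<and> e \<subseteq> {v \<in> verts G. \<phi> v = c})" if "c \<in> \<phi> ` verts G" for c
  proof -
    have "simple_graph (induced G {v \<in> verts G. \<phi> v = c})"
      by (rule simple_graph_induced[OF G]) (use that in auto)
    from max_degree_0_iff[OF this] show ?thesis by (auto simp: induced_def)
  qed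
  then have 1: "family_colouring (max_degree_at_most 0) G \<phi> \<longleftrightarrow>
      (\<forall>c\<in>\<phi> ` verts G. \<nexists>e. e \<in> edges G \<and> e \<subseteq> {v \<in> verts G. \<phi> v = c})"
    by (simp add: family_colouring_def)
  have 2: "\<exists>u v. e = {u, v} \<and> u \<in> verts G \<and> v \<in> verts G" if "e \<in> edges G" for e
  proof -
    have "e \<subseteq> verts G" "card e = 2" using G that by (auto simp: simple_graph_def)
    then show ?thesis by (auto simp: card_2_iff)
  qed
  show ?thesis unfolding 1
  proof
    assume h: "\<forall>c\<in>\<phi> ` verts G. \<nexists>e. e \<in> edges G \<and> e \<subseteq> {v \<in> verts G. \<phi> v = c}"
    show "proper_colouring G \<phi>" unfolding proper_colouring_def
    proof (intro allI impI notI)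
      fix u v assume e: "{u, v} \<in> edges G" and eq: "\<phi> u = \<phi> v"
      from e G have "{u, v} \<subseteq> verts G" by (auto simp: simple_graph_def)
      with eq have "{u, v} \<subseteq> {x \<in> verts G. \<phi> x = \<phi> u}" "\<phi> u \<in> \<phi> ` verts G" by auto
      with h e show False by blast
    qed
  next
    assume h: "proper_colouring G \<phi>"
    show "\<forall>c\<in>\<phi> ` verts G. \<nexists>e. e \<in> edges G \<and> e \<subseteq> {v \<in> verts G. \<phi> v = c}"
    proof (intro ballI notI, elim exE conjE)
      fix c e assume e: "e \<in> edges G" and s: "e \<subseteq> {v \<in> verts G. \<phi> v = c}"
      from 2[OF e] obtain u v where "e = {u, v}" by blast
      with s have "\<phi> u = \<phi> v" by auto
      with h e \<open>e = {u, v}\<close> show False unfolding proper_colouring_def by blast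
    qed
  qed
qed

lemma choice_number_eq:
  assumes "simple_graph G"
  shows "choice_number G = family_choice_number (max_degree_at_most 0) G"
proof -
  have "choosable n G \<longleftrightarrow> family_choosable (max_degree_at_most 0) n G" for n
    unfolding choosable_def family_choosable_def family_colouring_0_iff[OF assms] ..
  then show ?thesis by (simp add: choice_number_def family_choice_number_def)
qed

lemma distinct_representatives:
  assumes "finite V" "\<And>v. v \<in> V \<Longrightarrow> finite (L v) \<and> card V \<le> card (L v)"
  shows "\<exists>\<phi>. inj_on \<phi> V \<and> (\<forall>v\<in>V. \<phi> v \<in> L v)"
  using assms
proof (induction V rule: finite_induct)
  case (insert x V)
  have "finite (L v) \<and> card V \<le> card (L v)" if "v \<in> V" for v
    using insert.prems[of v] insert.hyps that by simp
  then obtain \<phi> where \<phi>: "inj_on \<phi> V" "\<forall>v\<in>V. \<phi> v \<in> L v" using insert.IH by blast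
  have "card (\<phi> ` V) < card (L x)"
    using insert.prems[of x] insert.hyps card_image_le[of V \<phi>] by simp
  then have "\<not> L x \<subseteq> \<phi> ` V" using insert.hyps by (meson card_mono finite_imageI leD)
  then obtain c where c: "c \<in> L x" "c \<notin> \<phi> ` V" by blast
  have "inj_on (\<phi>(x := c)) (insert x V)"
    using \<phi>(1) c(2) insert.hyps by (auto simp: inj_on_def)
  moreover have "\<forall>v\<in>insert x V. (\<phi>(x := c)) v \<in> L v" using \<phi>(2) c(1) by auto
  ultimately show ?case by blast
qed simp

text \<open>The minimum defining the choice number is attained for every family that contains
  the one-vertex graphs.\<close>

lemma family_choosable_card:
  assumes G: "simple_graph G"
    and K1: "\<And>v. v \<in> verts G \<Longrightarrow> \<lparr>verts = {v}, edges = {}\<rparr> \<in> \<G>"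
  shows "0 < card (verts G)" and "family_choosable \<G> (card (verts G)) G"
proof -
  have f: "finite (verts G)" "verts G \<noteq> {}" using G by (auto simp: simple_graph_def)
  then show "0 < card (verts G)" by (simp add: card_gt_0_iff)
  show "family_choosable \<G> (card (verts G)) G" unfolding family_choosable_def
  proof (intro allI impI)
    fix L :: "'a \<Rightarrow> nat set" assume "list_assignment (card (verts G)) G L"
    then obtain \<phi> where \<phi>: "inj_on \<phi> (verts G)" "\<forall>v\<in>verts G. \<phi> v \<in> L v"
      using distinct_representatives[OF f(1), of L] by (auto simp: list_assignment_def)
    have "induced G {u \<in> verts G. \<phi> u = \<phi> v} \<in> \<G>" if v: "v \<in> verts G" for v
    proof -
      have "{u \<in> verts G. \<phi> u = \<phi> v} = {v}" using \<phi>(1) v by (auto simp: inj_on_def)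
      moreover have "{e \<in> edges G. e \<subseteq> {v}} = {}"
        using G by (auto simp: simple_graph_def subset_singleton_iff)
      ultimately show ?thesis using K1[OF v] by (simp only: induced_def)
    qed
    then have "family_colouring \<G> G \<phi>" by (auto simp: family_colouring_def)
    with \<phi>(2) show "\<exists>\<phi>. family_colouring \<G> G \<phi> \<and> (\<forall>v\<in>verts G. \<phi> v \<in> L v)" by blast
  qed
qed

end

theory Submission
  imports Defs "HOL-Library.Disjoint_Sets"
begin

text \<open>The graph is a complete bipartite graph with parts \<open>A\<close> of size \<open>n = k (k + 1) - 1\<close> and a huge \<open>B\<close>.
  It is \<open>n\<close>-degenerate, so it is \<open>(n + 1)\<close>-choosable. With pairwise disjoint \<open>n\<close>-lists on \<open>A\<close> and each
  transversal of them as the list of \<open>n d + 1\<close> vertices of \<open>B\<close>, some colour class has a vertex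
  of degree more than \<open>d\<close>. For star forests, colour \<open>A\<close> from its \<open>k\<close>-lists so that at most \<open>k - 1\<close>
  colours are used more than once: give a colour to all vertices having it in their lists as long
  as there are at least \<open>k + 1\<close> of these, which happens at most \<open>k - 1\<close> times, and then use Hall's
  theorem. Every vertex of \<open>B\<close> still has a colour that occurs at most once on \<open>A\<close>, so each colour
  class is a star plus isolated vertices.\<close>

section \<open>Hall's theorem and list colourings with few repeated colours\<close>

text \<open>Induction on the size of \<open>V\<close>. If some nonempty proper subset
  \<open>X\<close> is tight, that is, its lists have exactly \<open>card X\<close> colours in total,
  represent \<open>X\<close> first and the rest outside those colours. If none is, any vertex may
  take any colour of its list, since every nonempty set of other vertices has a colour to
  spare.\<close>

lemma hall_marriage:
  assumes "finite V" "\<And>v. v \<in> V \<Longrightarrow> finite (L v)"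
    and "\<And>X. X \<subseteq> V \<Longrightarrow> card X \<le> card (\<Union>(L ` X))"
  shows "\<exists>\<phi>. inj_on \<phi> V \<and> (\<forall>v\<in>V. \<phi> v \<in> L v)"
  using assms
proof (induction "card V" arbitrary: V L rule: less_induct)
  case less
  note finV = less.prems(1) and finL = less.prems(2) and hall = less.prems(3)
  consider "V = {}"
    | (tight) X where "X \<noteq> {}" "X \<subset> V" "card (\<Union>(L ` X)) = card X"
    | (slack) "V \<noteq> {}" "\<And>X. X \<noteq> {} \<Longrightarrow> X \<subset> V \<Longrightarrow> card X < card (\<Union>(L ` X))"
    using hall by (metis le_neq_implies_less psubsetE)
  then show ?case
  proof cases
    case 1
    then show ?thesis by simp
  next
    case tight
    have finX: "finite X" using tight finV by (meson finite_subset psubset_imp_subset)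
    let ?U = "\<Union>(L ` X)"
    have "card X < card V" using tight finV by (simp add: psubset_card_mono)
    then have "\<exists>\<phi>. inj_on \<phi> X \<and> (\<forall>v\<in>X. \<phi> v \<in> L v)"
    proof (rule less.hyps)
      show "finite (L v)" if "v \<in> X" for v using that tight(2) finL by blast
      show "card Y \<le> card (\<Union>(L ` Y))" if "Y \<subseteq> X" for Y using that tight(2) by (intro hall) blast
    qed (rule finX)
    then obtain \<phi> where \<phi>: "inj_on \<phi> X" "\<forall>v\<in>X. \<phi> v \<in> L v" by blast
    have less': "card (V - X) < card V"
      using tight finV by (intro psubset_card_mono) auto
    \<comment> \<open>Hall's condition for \<open>X \<union> Y\<close> leaves at least
      \<open>card Y\<close> colours once the \<open>card X\<close> colours of \<open>?U\<close> are
      removed.\<close>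
    have hall': "card Y \<le> card (\<Union>((\<lambda>v. L v - ?U) ` Y))" if Y: "Y \<subseteq> V - X" for Y
    proof -
      have finY: "finite Y" using Y finV by (meson finite_Diff finite_subset)
      have "card X + card Y = card (X \<union> Y)"
        using Y finX finY by (intro card_Un_disjoint[symmetric]) auto
      also have "\<dots> \<le> card (\<Union>(L ` (X \<union> Y)))" using Y tight(2) by (intro hall) auto
      also have "\<Union>(L ` (X \<union> Y)) = ?U \<union> \<Union>((\<lambda>v. L v - ?U) ` Y)" by blast
      also have "card \<dots> \<le> card ?U + card (\<Union>((\<lambda>v. L v - ?U) ` Y))" by (rule card_Un_le)
      finally show ?thesis using tight(3) by simp
    qed
    have "\<exists>\<psi>. inj_on \<psi> (V - X) \<and> (\<forall>v\<in>V - X. \<psi> v \<in> L v - ?U)"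
      using finV finL hall' by (intro less.hyps[OF less']) auto
    then obtain \<psi> where \<psi>: "inj_on \<psi> (V - X)" "\<forall>v\<in>V - X. \<psi> v \<in> L v - ?U" by blast
    let ?\<chi> = "\<lambda>v. if v \<in> X then \<phi> v else \<psi> v"
    have "inj_on ?\<chi> V"
    proof (rule inj_onI)
      fix u v assume uv: "u \<in> V" "v \<in> V" "?\<chi> u = ?\<chi> v"
      have "?\<chi> w \<in> ?U \<longleftrightarrow> w \<in> X" if "w \<in> V" for w using that \<phi>(2) \<psi>(2) by auto
      then have "u \<in> X \<longleftrightarrow> v \<in> X" using uv by metis
      then show "u = v" using uv \<phi>(1) \<psi>(1) by (cases "u \<in> X") (auto dest: inj_onD)
    qed
    moreover have "\<forall>v\<in>V. ?\<chi> v \<in> L v" using \<phi>(2) \<psi>(2) by auto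
    ultimately show ?thesis by blast
  next
    case slack
    then obtain v where v: "v \<in> V" by blast
    have "card {v} \<le> card (L v)" using hall[of "{v}"] v by simp
    then obtain c where c: "c \<in> L v" by fastforce
    have less': "card (V - {v}) < card V" using v finV by (intro psubset_card_mono) auto
    \<comment> \<open>A nonempty such \<open>Y\<close> is a proper subset of \<open>V\<close>, so
      the strict inequality pays for the loss of \<open>c\<close>.\<close>
    have hall': "card Y \<le> card (\<Union>((\<lambda>u. L u - {c}) ` Y))" if Y: "Y \<subseteq> V - {v}" for Y
    proof (cases "Y = {}")
      case False
      have "card Y < card (\<Union>(L ` Y))" using Y v by (intro slack(2) False) auto
      then have "card Y \<le> card (\<Union>(L ` Y)) - card {c}" by simp
      also have "\<dots> \<le> card (\<Union>(L ` Y) - {c})" by (rule diff_card_le_card_Diff) simp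
      also have "\<Union>(L ` Y) - {c} = \<Union>((\<lambda>u. L u - {c}) ` Y)" by blast
      finally show ?thesis .
    qed simp
    have "\<exists>\<psi>. inj_on \<psi> (V - {v}) \<and> (\<forall>u\<in>V - {v}. \<psi> u \<in> L u - {c})"
      using finV finL hall' by (intro less.hyps[OF less']) auto
    then obtain \<psi> where \<psi>: "inj_on \<psi> (V - {v})" "\<forall>u\<in>V - {v}. \<psi> u \<in> L u - {c}" by blast
    have "inj_on (\<psi>(v := c)) V" using \<psi> by (auto simp: inj_on_def)
    moreover have "\<forall>u\<in>V. (\<psi>(v := c)) u \<in> L u" using \<psi>(2) c by auto
    ultimately show ?thesis by blast
  qed
qed

text \<open>Double counting of the pairs \<open>(v, c)\<close> with \<open>v \<in> X\<close> and
  \<open>c \<in> L v\<close>: each vertex of \<open>X\<close> is in exactly \<open>k\<close> of them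
  and each colour in at most \<open>k\<close>, which gives Hall's condition.\<close>

lemma regular_distinct_representatives:
  assumes fin: "finite V" and k: "0 < k"
    and L: "\<And>v. v \<in> V \<Longrightarrow> finite (L v) \<and> card (L v) = k"
    and deg: "\<And>c. card {v \<in> V. c \<in> L v} \<le> k"
  shows "\<exists>\<phi>. inj_on \<phi> V \<and> (\<forall>v\<in>V. \<phi> v \<in> L v)"
proof (rule hall_marriage[OF fin])
  fix X assume X: "X \<subseteq> V"
  let ?C = "\<Union>(L ` X)"
  have finX: "finite X" using X fin finite_subset by blast
  have finC: "finite ?C" using finX X L by blast
  have "card X * k = (\<Sum>v\<in>X. card (L v))" using X L by (simp add: subset_eq)
  also have "\<dots> = card (SIGMA v:X. L v)" using X L finX by (subst card_SigmaI) auto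
  also have "\<dots> = card (prod.swap ` (SIGMA v:X. L v))" by (simp add: card_image)
  also have "prod.swap ` (SIGMA v:X. L v) = (SIGMA c:?C. {v \<in> X. c \<in> L v})" by force
  also have "card \<dots> = (\<Sum>c\<in>?C. card {v \<in> X. c \<in> L v})"
    using finX finC by (subst card_SigmaI) auto
  also have "\<dots> \<le> (\<Sum>c\<in>?C. k)"
  proof (rule sum_mono)
    fix c
    have "card {v \<in> X. c \<in> L v} \<le> card {v \<in> V. c \<in> L v}" using X fin by (intro card_mono) auto
    with deg[of c] show "card {v \<in> X. c \<in> L v} \<le> k" by simp
  qed
  finally show "card X \<le> card ?C" using k by simp
qed (use L in blast)

text \<open>\<open>R\<close> collects the colours that may be used more than once. Adding a colour
  to \<open>R\<close> disposes of at least \<open>k + 1\<close> vertices, so after at most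
  \<open>r\<close> additions either no colour is in more than \<open>k\<close> lists or at most
  \<open>k\<close> vertices are left. Both cases admit distinct colours.\<close>

lemma few_repeated_colours:
  assumes "finite V" and k: "0 < k"
    and "\<And>v. v \<in> V \<Longrightarrow> finite (L v) \<and> card (L v) = k"
    and "card V < Suc r * Suc k"
  shows "\<exists>\<phi> R. finite R \<and> card R \<le> r \<and> (\<forall>v\<in>V. \<phi> v \<in> L v) \<and> inj_on \<phi> {v \<in> V. \<phi> v \<notin> R}"
  using assms(1,3,4)
proof (induction r arbitrary: V)
  case 0
  then have "card V \<le> k" by simp
  then have "\<exists>\<phi>. inj_on \<phi> V \<and> (\<forall>v\<in>V. \<phi> v \<in> L v)"
    using 0 by (intro distinct_representatives) auto
  then obtain \<phi> where "inj_on \<phi> V" "\<forall>v\<in>V. \<phi> v \<in> L v" by blast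
  then show ?case by (intro exI[of _ \<phi>] exI[of _ "{}"]) simp
next
  case (Suc r)
  show ?case
  proof (cases "\<exists>c. k < card {v \<in> V. c \<in> L v}")
    case False
    then have "\<exists>\<phi>. inj_on \<phi> V \<and> (\<forall>v\<in>V. \<phi> v \<in> L v)"
      using Suc.prems k by (intro regular_distinct_representatives[of V k]) (auto simp: not_less)
    then obtain \<phi> where "inj_on \<phi> V" "\<forall>v\<in>V. \<phi> v \<in> L v" by blast
    then show ?thesis by (intro exI[of _ \<phi>] exI[of _ "{}"]) simp
  next
    case True
    then obtain c where c: "Suc k \<le> card {v \<in> V. c \<in> L v}" by (auto simp: Suc_le_eq)
    let ?W = "{v \<in> V. c \<notin> L v}"
    have "card {v \<in> V. c \<in> L v} + card ?W = card ({v \<in> V. c \<in> L v} \<union> ?W)"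
      using Suc.prems(1) by (intro card_Un_disjoint[symmetric]) auto
    also have "{v \<in> V. c \<in> L v} \<union> ?W = V" by blast
    finally have "card ?W < Suc r * Suc k" using c Suc.prems(3) by simp
    then obtain \<phi> R where \<phi>: "finite R" "card R \<le> r" "\<forall>v\<in>?W. \<phi> v \<in> L v"
        "inj_on \<phi> {v \<in> ?W. \<phi> v \<notin> R}"
      using Suc.IH[of ?W] Suc.prems by auto
    \<comment> \<open>All vertices with \<open>c\<close> in their lists receive \<open>c\<close>.
      The vertices coloured outside \<open>insert c R\<close> then lie in \<open>?W\<close>, where
      the induction hypothesis gives injectivity.\<close>
    let ?\<psi> = "\<lambda>v. if c \<in> L v then c else \<phi> v"
    have "inj_on ?\<psi> {v \<in> V. ?\<psi> v \<notin> insert c R}"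
      using \<phi>(4) by (auto simp: inj_on_def)
    moreover have "card (insert c R) \<le> Suc r" using \<phi>(1,2) by (simp add: card_insert_if)
    ultimately show ?thesis using \<phi>(1,3)
      by (intro exI[of _ ?\<psi>] exI[of _ "insert c R"]) auto
  qed
qed

section \<open>Star forests, forests and maximum average degree\<close>

lemma simple_graph_edgeE:
  assumes "simple_graph G" "e \<in> edges G"
  obtains u v where "e = {u, v}" "u \<noteq> v" "u \<in> verts G" "v \<in> verts G"
proof -
  have "e \<subseteq> verts G" "card e = 2" using assms by (auto simp: simple_graph_def)
  moreover from this obtain u v where "e = {u, v}" "u \<noteq> v" by (auto simp: card_2_iff)
  ultimately show ?thesis using that by simp
qed

lemma simple_graph_edge:
  assumes "simple_graph G" "{u, v} \<in> edges G"
  shows "u \<noteq> v" "u \<in> verts G" "v \<in> verts G"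
proof -
  have "{u, v} \<subseteq> verts G" "card {u, v} = 2" using assms unfolding simple_graph_def by blast+
  then show "u \<noteq> v" "u \<in> verts G" "v \<in> verts G" by auto
qed

text \<open>A component with an edge consists of \<open>c\<close> and its neighbours, because each
  of its edges passes through \<open>c\<close>; a component without edges is a single vertex. The
  colour classes of the bipartite graph will have this shape.\<close>

lemma star_forestI:
  assumes G: "simple_graph G" and c: "\<And>e. e \<in> edges G \<Longrightarrow> c \<in> e"
  shows "G \<in> star_forests"
proof -
  let ?r = "{(x, y). {x, y} \<in> edges G}"
  let ?A = "{a. {c, a} \<in> edges G}"
  have finA: "finite ?A"
    using G simple_graph_edge[OF G] by (auto simp: simple_graph_def intro: finite_subset[of _ "verts G"])
  have "is_star (induced G (?r\<^sup>* `` {v}))" if v: "v \<in> verts G" for v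
  proof (cases "\<exists>w. {v, w} \<in> edges G")
    case False
    have "w = v" if "(v, w) \<in> ?r\<^sup>*" for w
      using that by (rule converse_rtranclE) (use False in auto)
    then have "?r\<^sup>* `` {v} = {v}" by auto
    moreover have "{e \<in> edges G. e \<subseteq> {v}} = {}"
      by (auto elim!: simple_graph_edgeE[OF G])
    ultimately show ?thesis by (auto simp: is_star_def induced_def)
  next
    case True
    then obtain w where w: "{v, w} \<in> edges G" by blast
    have sub: "x \<in> insert c ?A" if "(v, x) \<in> ?r\<^sup>*" for x
      using that
    proof (induction rule: rtrancl_induct)
      case base
      from c[OF w] w show ?case by (auto simp: insert_commute)
    next
      case (step x y)
      then have "{x, y} \<in> edges G" by simp
      with c[OF this] show ?case by (auto simp: insert_commute)
    qed
    have vc: "(v, c) \<in> ?r\<^sup>*" using c[OF w] w by auto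
    have "(v, x) \<in> ?r\<^sup>*" if "x \<in> ?A" for x
      using vc that by (auto intro: rtrancl_into_rtrancl)
    with sub vc have C: "?r\<^sup>* `` {v} = insert c ?A" by blast
    have "{e \<in> edges G. e \<subseteq> insert c ?A} = {{c, a} | a. a \<in> ?A}"
    proof (intro equalityI subsetI)
      fix e assume "e \<in> {e \<in> edges G. e \<subseteq> insert c ?A}"
      then have e: "e \<in> edges G" by simp
      then obtain x y where "e = {x, y}" "x \<noteq> y" by (rule simple_graph_edgeE[OF G])
      with c[OF e] e show "e \<in> {{c, a} | a. a \<in> ?A}" by (auto simp: insert_commute)
    qed auto
    moreover have "c \<notin> ?A" using simple_graph_edge(1)[OF G, of c c] by blast
    ultimately show ?thesis unfolding C is_star_def induced_def
      using finA by (intro exI[of _ c] exI[of _ ?A]) simp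
  qed
  with G show ?thesis by (simp add: star_forests_def components_def)
qed

text \<open>Three consecutive edges of a cycle lie in one component and so share the centre of a
  star. The first two meet only in their common end, which is not on the third.\<close>

lemma star_forests_subset_forests: "star_forests \<subseteq> forests"
proof
  fix G :: "'a sgraph" assume G: "G \<in> star_forests"
  then have sG: "simple_graph G" by (simp add: star_forests_def)
  have False if cyc: "is_cycle G xs" for xs
  proof -
    from cyc have len: "3 \<le> length xs" and d: "distinct xs"
      and e: "\<And>i. i < length xs \<Longrightarrow> {xs ! i, xs ! (Suc i mod length xs)} \<in> edges G"
      by (auto simp: is_cycle_def)
    \<comment> \<open>The index after 2 on the cycle; it wraps around to 0 in a triangle.\<close>
    let ?j = "3 mod length xs"
    have "?j = (if length xs = 3 then 0 else 3)" using len by simp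
    then have j: "?j < length xs" "?j \<noteq> 1" "0 < length xs" "1 < length xs" "2 < length xs"
      using len by (auto split: if_splits)
    have e0: "{xs ! 0, xs ! 1} \<in> edges G" using e[of 0] len j by simp
    have e1: "{xs ! 1, xs ! 2} \<in> edges G" using e[of 1] len j by (simp add: numeral_2_eq_2)
    have e2: "{xs ! 2, xs ! ?j} \<in> edges G" using e[of 2] j by (simp add: numeral_3_eq_3)
    let ?r = "{(x, y). {x, y} \<in> edges G}"
    let ?C = "?r\<^sup>* `` {xs ! 1}"
    have r1: "(xs ! 1, xs ! 0) \<in> ?r\<^sup>*" using e0 by (auto simp: insert_commute)
    have r2: "(xs ! 1, xs ! 2) \<in> ?r\<^sup>*" using e1 by auto
    then have r3: "(xs ! 1, xs ! ?j) \<in> ?r\<^sup>*" using e2 by (auto intro: rtrancl_into_rtrancl)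
    have "xs ! 1 \<in> verts G" using simple_graph_edge[OF sG e0] by simp
    with G have "is_star (induced G ?C)" by (auto simp: star_forests_def components_def)
    then obtain c A where "edges (induced G ?C) = {{c, a} | a. a \<in> A}"
      unfolding is_star_def by blast
    then have centre: "c \<in> e" if "e \<in> edges (induced G ?C)" for e using that by auto
    have "c \<in> {xs ! 0, xs ! 1}" "c \<in> {xs ! 1, xs ! 2}" "c \<in> {xs ! 2, xs ! ?j}"
      by (rule centre, use e0 e1 e2 r1 r2 r3 in \<open>simp add: induced_def\<close>)+
    moreover have "xs ! 0 \<noteq> xs ! 1" "xs ! 0 \<noteq> xs ! 2" "xs ! 1 \<noteq> xs ! 2" "xs ! 1 \<noteq> xs ! ?j"
      using d j by (simp_all add: nth_eq_iff_index_eq)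
    ultimately show False by auto
  qed
  with sG show "G \<in> forests" by (auto simp: forests_def)
qed

text \<open>An end vertex of a longest path has all its neighbours on the path; one that is not next to it
  on the path closes a cycle.\<close>

lemma cycle_of_min_degree_2:
  assumes fin: "finite V" and ne: "V \<noteq> {}"
    and sub: "\<And>u v. {u, v} \<in> edges G \<Longrightarrow> u \<noteq> v"
    and nb: "\<And>u w. u \<in> V \<Longrightarrow> \<exists>v\<in>V. v \<noteq> w \<and> {u, v} \<in> edges G"
  shows "\<exists>xs. is_cycle G xs"
proof -
  let ?P = "\<lambda>xs. distinct xs \<and> set xs \<subseteq> V \<and> xs \<noteq> [] \<and>
     (\<forall>i. Suc i < length xs \<longrightarrow> {xs ! i, xs ! Suc i} \<in> edges G)"
  obtain v0 where "v0 \<in> V" using ne by blast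
  then have "?P [v0]" by simp
  moreover have "\<forall>xs. ?P xs \<longrightarrow> length xs < Suc (card V)"
    using fin by (metis card_mono distinct_card less_Suc_eq_le)
  ultimately obtain xs where P: "?P xs" and mx: "\<And>ys. ?P ys \<Longrightarrow> length ys \<le> length xs"
    using ex_has_greatest_nat[of ?P "[v0]" length "Suc (card V)"] by blast
  obtain x xs' where xs: "xs = x # xs'" using P by (cases xs) auto
  have inxs: "v \<in> set xs" if "v \<in> V" "{x, v} \<in> edges G" for v
  proof (rule ccontr)
    assume "v \<notin> set xs"
    then have "?P (v # xs)"
      using P that by (auto simp: xs nth_Cons insert_commute split: nat.splits)
    from mx[OF this] show False by simp
  qed
  have "x \<in> V" using P xs by simp
  \<comment> \<open>On a path with one vertex \<open>xs ! 1\<close> is an unspecified value. This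
    does no harm: \<open>v\<close> lies on the path and differs from \<open>x\<close>, which rules
    that case out.\<close>
  with nb obtain v where v: "v \<in> V" "v \<noteq> xs ! 1" "{x, v} \<in> edges G" by blast
  from inxs[OF v(1,3)] obtain i where i: "i < length xs" "xs ! i = v" by (auto simp: in_set_conv_nth)
  have "i \<noteq> 0" using sub[OF v(3)] i by (cases i) (auto simp: xs)
  moreover have "i \<noteq> 1" using v i by auto
  ultimately have i2: "2 \<le> i" by simp
  let ?ys = "take (Suc i) xs"
  have len: "length ?ys = Suc i" using i by simp
  have "is_cycle G ?ys" unfolding is_cycle_def
  proof (intro conjI allI impI)
    show "3 \<le> length ?ys" using len i2 by simp
    show "distinct ?ys" using P by simp
    fix j assume j: "j < length ?ys"
    show "{?ys ! j, ?ys ! (Suc j mod length ?ys)} \<in> edges G"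
    proof (cases "j = i")
      case True
      then have "?ys ! j = v" "?ys ! (Suc j mod length ?ys) = x" using True len i by (simp_all only: nth_take lessI mod_self) (simp_all add: xs)
      with v(3) show ?thesis by (simp add: insert_commute)
    next
      case False
      then show ?thesis using len i j P by simp
    qed
  qed
  then show ?thesis by blast
qed

text \<open>A nonempty acyclic graph has a vertex with at most one neighbour, and deleting it costs
  at most one edge. The bound \<open>card V\<close> is enough for average degree 2 and also covers
  empty \<open>V\<close>, the base of the induction.\<close>

lemma acyclic_card_edges_le:
  assumes "finite V" and "\<And>e. e \<in> E \<Longrightarrow> e \<subseteq> V \<and> card e = 2"
    and "\<nexists>xs. is_cycle \<lparr>verts = V, edges = E\<rparr> xs"
  shows "card E \<le> card V"
  using assms
proof (induction "card V" arbitrary: V E rule: less_induct)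
  case less
  note finV = less.prems(1) and E = less.prems(2) and acyc = less.prems(3)
  have finE: "finite E" using finV E by (intro finite_subset[of E "Pow V"]) auto
  show ?case
  proof (cases "V = {}")
    case True
    with E have "E = {}" by force
    then show ?thesis by simp
  next
    case False
    have loop: "u \<noteq> v" if "{u, v} \<in> E" for u v using E[OF that] by (auto simp: card_2_iff)
    \<comment> \<open>This negates the degree hypothesis of \<open>cycle_of_min_degree_2\<close>;
      \<open>w\<close> is the only neighbour of \<open>u\<close>, or arbitrary if \<open>u\<close>
      is isolated.\<close>
    have "\<exists>u w. u \<in> V \<and> (\<forall>v\<in>V. {u, v} \<in> E \<longrightarrow> v = w)"
    proof (rule ccontr)
      assume "\<not> ?thesis"
      then have "\<exists>xs. is_cycle \<lparr>verts = V, edges = E\<rparr> xs"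
        using loop by (intro cycle_of_min_degree_2[OF finV False]) (simp_all, blast)
      with acyc show False by blast
    qed
    then obtain u w where u: "u \<in> V" and w: "\<And>v. v \<in> V \<Longrightarrow> {u, v} \<in> E \<Longrightarrow> v = w" by blast
    let ?E = "{e \<in> E. u \<notin> e}"
    have "e = {u, w}" if e: "e \<in> E" "u \<in> e" for e
    proof -
      obtain v where "e = {u, v}" using E[OF e(1)] e(2) by (auto simp: card_2_iff doubleton_eq_iff)
      with w[of v] E[OF e(1)] e(1) show ?thesis by auto
    qed
    then have "E \<subseteq> insert {u, w} ?E" by blast
    then have "card E \<le> card (insert {u, w} ?E)" using finE by (intro card_mono) auto
    also have "\<dots> \<le> Suc (card ?E)" using finE by (simp add: card_insert_if)
    also have "card ?E \<le> card (V - {u})"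
    proof (rule less.hyps)
      show "card (V - {u}) < card V" using u finV by (intro psubset_card_mono) auto
      show "\<And>e. e \<in> ?E \<Longrightarrow> e \<subseteq> V - {u} \<and> card e = 2" using E by blast
      show "\<nexists>xs. is_cycle \<lparr>verts = V - {u}, edges = ?E\<rparr> xs"
        using acyc by (auto simp: is_cycle_def)
    qed (use finV in simp)
    finally show ?thesis using card_Suc_Diff1[OF finV u] by simp
  qed
qed

text \<open>Subgraphs of a forest are acyclic, so none has more edges than vertices.\<close>

lemma forests_subset_mad_2: "forests \<subseteq> mad_at_most 2"
proof
  fix G :: "'a sgraph" assume "G \<in> forests"
  then have sG: "simple_graph G" and acyc: "\<nexists>xs. is_cycle G xs" by (auto simp: forests_def)
  let ?f = "\<lambda>H :: 'a sgraph. 2 * real (card (edges H)) / real (card (verts H))"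
  \<comment> \<open>A subgraph is given by a set of vertices and a set of edges, so there are
    finitely many and \<open>Max\<close> is a true maximum.\<close>
  have "{H. subgraph H G} \<subseteq> (\<lambda>(V, E). \<lparr>verts = V, edges = E\<rparr>) ` (Pow (verts G) \<times> Pow (edges G))"
  proof
    fix H assume "H \<in> {H. subgraph H G}"
    then show "H \<in> (\<lambda>(V, E). \<lparr>verts = V, edges = E\<rparr>) ` (Pow (verts G) \<times> Pow (edges G))"
      by (intro image_eqI[of _ _ "(verts H, edges H)"]) (auto simp: subgraph_def)
  qed
  then have "finite {H. subgraph H G}"
    by (rule finite_subset) (use sG finite_edges[OF sG] in \<open>auto simp: simple_graph_def\<close>)
  then have fin: "finite {?f H | H. subgraph H G}" by simp
  have ne: "{?f H | H. subgraph H G} \<noteq> {}" using sG by (auto simp: subgraph_def)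
  have "?f H \<le> 2" if "subgraph H G" for H
  proof -
    from that have H: "simple_graph H" "edges H \<subseteq> edges G" by (auto simp: subgraph_def)
    have "card (edges H) \<le> card (verts H)"
    proof (rule acyclic_card_edges_le)
      show "\<nexists>xs. is_cycle \<lparr>verts = verts H, edges = edges H\<rparr> xs"
        using acyc H(2) by (fastforce simp: is_cycle_def)
    qed (use H in \<open>auto simp: simple_graph_def\<close>)
    then show ?thesis by (auto simp: divide_le_eq)
  qed
  then have "Max {?f H | H. subgraph H G} \<le> 2" using fin ne by (subst Max_le_iff) auto
  with sG show "G \<in> mad_at_most 2" by (simp add: mad_at_most_def max_avg_degree_def)
qed

section \<open>Monotonicity in the list size and in the family\<close>

text \<open>Colour from sublists of size \<open>m\<close>. It follows that failure at one list size
  rules out all smaller sizes, which is how a choice number is bounded from below.\<close>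

lemma family_choosable_mono:
  assumes "family_choosable \<G> m G" "m \<le> n"
  shows "family_choosable \<G> n G"
  unfolding family_choosable_def
proof (intro allI impI)
  fix L :: "'a \<Rightarrow> nat set" assume L: "list_assignment n G L"
  have "\<exists>S\<subseteq>L v. finite S \<and> card S = m" if "v \<in> verts G" for v
    using L that assms(2) by (metis list_assignment_def obtain_subset_with_card_n)
  then obtain L' where "\<forall>v\<in>verts G. L' v \<subseteq> L v \<and> finite (L' v) \<and> card (L' v) = m" by metis
  moreover from this obtain \<phi> where "family_colouring \<G> G \<phi>" "\<forall>v\<in>verts G. \<phi> v \<in> L' v"
    using assms(1) unfolding family_choosable_def list_assignment_def by blast
  ultimately show "\<exists>\<phi>. family_colouring \<G> G \<phi> \<and> (\<forall>v\<in>verts G. \<phi> v \<in> L v)" by blast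
qed

lemma family_choosable_family_mono:
  assumes "family_choosable \<G> n G" "\<G> \<subseteq> \<H>"
  shows "family_choosable \<H> n G"
  using assms unfolding family_choosable_def family_colouring_def by blast

lemma star_forests_singleton: "\<lparr>verts = {v}, edges = {}\<rparr> \<in> star_forests"
  by (rule star_forestI) (auto simp: simple_graph_def)

text \<open>Star forests include the one-vertex graphs, so the \<open>LEAST\<close> for
  \<open>\<G>\<close> is attained, and its value also works for the larger family
  \<open>\<H>\<close>.\<close>

lemma family_choice_number_antimono:
  assumes G: "simple_graph G" and star: "star_forests \<subseteq> \<G>" and sub: "\<G> \<subseteq> \<H>"
  shows "family_choice_number \<H> G \<le> family_choice_number \<G> G"
proof -
  let ?n = "family_choice_number \<G> G"
  have "\<lparr>verts = {v}, edges = {}\<rparr> \<in> \<G>" for v using star star_forests_singleton by (rule subsetD)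
  note family_choosable_card[OF G this]
  then have "0 < card (verts G) \<and> family_choosable \<G> (card (verts G)) G" by (rule conjI)
  then have "0 < ?n \<and> family_choosable \<G> ?n G"
    unfolding family_choice_number_def by (rule LeastI)
  then show ?thesis
    using family_choosable_family_mono[OF _ sub] unfolding family_choice_number_def[of \<H>]
    by (intro Least_le) auto
qed

section \<open>List colourings of complete bipartite graphs\<close>

definition complete_bipartite :: "'a set \<Rightarrow> 'a set \<Rightarrow> 'a sgraph" where
  "complete_bipartite A B = \<lparr>verts = A \<union> B, edges = {{a, b} | a b. a \<in> A \<and> b \<in> B}\<rparr>"

context
  fixes A B :: "'a set"
  assumes AB: "finite A" "finite B" "A \<inter> B = {}" "A \<union> B \<noteq> {}"
begin

lemma simple_complete_bipartite: "simple_graph (complete_bipartite A B)"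
  unfolding simple_graph_def complete_bipartite_def using AB
  by (auto simp: card_insert_if)

text \<open>Colour \<open>A\<close> with at most \<open>k - 1\<close> repeated colours. Lists of
  size \<open>k\<close> let every vertex of \<open>B\<close> avoid these, so a colour present on
  both sides occurs only once on \<open>A\<close>.\<close>

lemma complete_bipartite_star_choosable:
  assumes k: "0 < k" and card: "card A < k * Suc k"
  shows "family_choosable star_forests k (complete_bipartite A B)"
  unfolding family_choosable_def
proof (intro allI impI)
  let ?G = "complete_bipartite A B"
  fix L :: "'a \<Rightarrow> nat set" assume "list_assignment k ?G L"
  then have L: "finite (L v) \<and> card (L v) = k" if "v \<in> A \<union> B" for v
    using that by (auto simp: list_assignment_def complete_bipartite_def)
  have "card A < Suc (k - 1) * Suc k" using k card by simp
  then obtain \<phi> R where \<phi>: "finite R" "card R \<le> k - 1" "\<forall>v\<in>A. \<phi> v \<in> L v"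
      "inj_on \<phi> {v \<in> A. \<phi> v \<notin> R}"
    using few_repeated_colours[OF AB(1) k, of L "k - 1"] L by auto
  have "\<exists>c. c \<in> L b \<and> c \<notin> R" if "b \<in> B" for b
  proof -
    have "card R < card (L b)" using L[of b] that \<phi>(2) k by simp
    then show ?thesis using \<phi>(1) by (metis card_mono leD subsetI)
  qed
  then obtain \<psi> where \<psi>: "\<And>b. b \<in> B \<Longrightarrow> \<psi> b \<in> L b \<and> \<psi> b \<notin> R" by metis
  let ?\<chi> = "\<lambda>v. if v \<in> A then \<phi> v else \<psi> v"
  have "induced ?G {v \<in> verts ?G. ?\<chi> v = c} \<in> star_forests" if "c \<in> ?\<chi> ` verts ?G" for c
  proof -
    let ?W = "{v \<in> verts ?G. ?\<chi> v = c}"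
    have ab: "\<exists>a b. e = {a, b} \<and> a \<in> A \<and> \<phi> a = c \<and> b \<in> B \<and> c \<notin> R"
      if "e \<in> edges (induced ?G ?W)" for e
    proof -
      from that obtain a b where e: "e = {a, b}" "a \<in> A" "b \<in> B" "?\<chi> a = c" "?\<chi> b = c"
        by (auto simp: induced_def complete_bipartite_def)
      then have "b \<notin> A" using AB(3) by blast
      with e \<psi>[OF e(3)] have "\<phi> a = c" "c \<notin> R" by auto
      with e show ?thesis by blast
    qed
    \<comment> \<open>The vertex of \<open>A\<close> with colour \<open>c\<close> is the centre; in
      a class without edges the condition is vacuous.\<close>
    obtain a where "\<And>e. e \<in> edges (induced ?G ?W) \<Longrightarrow> a \<in> e"
    proof (cases "edges (induced ?G ?W) = {}")
      case False
      then obtain a where a: "a \<in> A" "\<phi> a = c" "c \<notin> R" using ab by blast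
      have "a \<in> e" if "e \<in> edges (induced ?G ?W)" for e
        using ab[OF that] a \<phi>(4) by (auto simp: inj_on_def)
      then show ?thesis by (rule that)
    qed (use that in simp)
    moreover have "simple_graph (induced ?G ?W)"
      using that by (intro simple_graph_induced simple_complete_bipartite) auto
    ultimately show ?thesis by (intro star_forestI)
  qed
  then have "family_colouring star_forests ?G ?\<chi>" unfolding family_colouring_def by blast
  moreover have "\<forall>v\<in>verts ?G. ?\<chi> v \<in> L v"
    using \<phi>(3) \<psi> by (auto simp: complete_bipartite_def)
  ultimately show "\<exists>\<phi>. family_colouring star_forests ?G \<phi> \<and> (\<forall>v\<in>verts ?G. \<phi> v \<in> L v)"
    by blast
qed

text \<open>However \<open>A\<close> is coloured, it uses at most \<open>card A\<close> colours, so
  each vertex of \<open>B\<close> has a colour left that is absent from \<open>A\<close>. This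
  settles \<open>d = 0\<close>, and the families grow with \<open>d\<close>.\<close>

lemma complete_bipartite_choosable:
  "family_choosable (max_degree_at_most d) (Suc (card A)) (complete_bipartite A B)"
proof (rule family_choosable_family_mono)
  let ?G = "complete_bipartite A B"
  show "max_degree_at_most 0 \<subseteq> max_degree_at_most d" by (auto simp: max_degree_at_most_def)
  show "family_choosable (max_degree_at_most 0) (Suc (card A)) ?G"
    unfolding family_choosable_def family_colouring_0_iff[OF simple_complete_bipartite]
  proof (intro allI impI)
    fix L :: "'a \<Rightarrow> nat set" assume "list_assignment (Suc (card A)) ?G L"
    then have L: "finite (L v) \<and> card (L v) = Suc (card A)" if "v \<in> A \<union> B" for v
      using that by (auto simp: list_assignment_def complete_bipartite_def)
    obtain \<phi> where \<phi>: "\<forall>v\<in>A. \<phi> v \<in> L v"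
      using distinct_representatives[OF AB(1), of L] L by auto
    have "\<exists>c. c \<in> L b \<and> c \<notin> \<phi> ` A" if "b \<in> B" for b
    proof -
      have "card (\<phi> ` A) < card (L b)" using L[of b] that card_image_le[OF AB(1), of \<phi>] by simp
      then show ?thesis using AB(1) by (metis card_mono finite_imageI leD subsetI)
    qed
    then obtain \<psi> where \<psi>: "\<And>b. b \<in> B \<Longrightarrow> \<psi> b \<in> L b \<and> \<psi> b \<notin> \<phi> ` A" by metis
    let ?\<chi> = "\<lambda>v. if v \<in> A then \<phi> v else \<psi> v"
    have *: "?\<chi> a \<noteq> ?\<chi> b" if "a \<in> A" "b \<in> B" for a b
    proof -
      have "b \<notin> A" using that AB(3) by blast
      with \<psi>[OF that(2)] that(1) show ?thesis by (metis imageI)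
    qed
    have "proper_colouring ?G ?\<chi>"
      unfolding proper_colouring_def
    proof (intro allI impI)
      fix u v assume "{u, v} \<in> edges ?G"
      then obtain a b where "{u, v} = {a, b}" and ab: "a \<in> A" "b \<in> B"
        by (auto simp: complete_bipartite_def)
      then have "u = a \<and> v = b \<or> u = b \<and> v = a" by (simp add: doubleton_eq_iff)
      with *[OF ab] show "?\<chi> u \<noteq> ?\<chi> v" by metis
    qed
    moreover have "\<forall>v\<in>verts ?G. ?\<chi> v \<in> L v"
      using \<phi> \<psi> by (auto simp: complete_bipartite_def)
    ultimately show "\<exists>\<phi>. proper_colouring ?G \<phi> \<and> (\<forall>v\<in>verts ?G. \<phi> v \<in> L v)" by blast
  qed
qed

text \<open>\<open>\<beta>\<close> labels the vertices of \<open>B\<close> by a transversal of the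
  lists on \<open>A\<close> and a counter, so each transversal is the list of
  \<open>card A * d + 1\<close> vertices. Any colouring of \<open>A\<close> from its lists is such a
  transversal, and the vertices labelled by it can only reuse colours of \<open>A\<close>.\<close>

lemma complete_bipartite_not_choosable:
  fixes K :: "'a \<Rightarrow> nat set"
  assumes K: "\<And>a. a \<in> A \<Longrightarrow> finite (K a) \<and> card (K a) = card A"
    and disj: "disjoint_family_on K A"
    and B: "bij_betw \<beta> B ((\<Pi>\<^sub>E a\<in>A. K a) \<times> {..card A * d})"
  shows "\<not> family_choosable (max_degree_at_most d) (card A) (complete_bipartite A B)"
proof
  let ?G = "complete_bipartite A B" and ?L = "\<lambda>v. if v \<in> A then K v else fst (\<beta> v) ` A"
  \<comment> \<open>Disjoint lists make transversals injective, so the lists on \<open>B\<close>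
    have exactly \<open>card A\<close> colours.\<close>
  have inj: "inj_on f A" if "f \<in> (\<Pi>\<^sub>E a\<in>A. K a)" for f
  proof (rule inj_onI, rule ccontr)
    fix a b assume "a \<in> A" "b \<in> A" "f a = f b" "a \<noteq> b"
    with that have "f a \<in> K a" "f a \<in> K b" by (auto simp: PiE_iff)
    with disj \<open>a \<in> A\<close> \<open>b \<in> A\<close> \<open>a \<noteq> b\<close> show False by (auto simp: disjoint_family_on_def)
  qed
  have \<beta>: "fst (\<beta> b) \<in> (\<Pi>\<^sub>E a\<in>A. K a)" if "b \<in> B" for b
    using bij_betwE[OF B] that by (auto simp: mem_Times_iff)
  assume "family_choosable (max_degree_at_most d) (card A) ?G"
  moreover have "list_assignment (card A) ?G ?L"
    using K AB(1) \<beta> card_image[OF inj] by (auto simp: list_assignment_def complete_bipartite_def)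
  ultimately obtain \<phi> where col: "family_colouring (max_degree_at_most d) ?G \<phi>"
    and \<phi>: "\<forall>v\<in>verts ?G. \<phi> v \<in> ?L v" unfolding family_choosable_def by blast
  \<comment> \<open>Functions in \<open>PiE\<close> are undefined outside \<open>A\<close>, hence
    the restriction.\<close>
  define f where "f = restrict \<phi> A"
  define T where "T = {b \<in> B. fst (\<beta> b) = f}"
  have "\<phi> v \<in> K v" if "v \<in> A" for v using \<phi> that by (force simp: complete_bipartite_def)
  then have f: "f \<in> (\<Pi>\<^sub>E a\<in>A. K a)" by (auto simp: f_def)
  have "\<beta> ` T = {x \<in> \<beta> ` B. fst x = f}" unfolding T_def by blast
  also have "\<dots> = {f} \<times> {..card A * d}"
    using f unfolding bij_betw_imp_surj_on[OF B] by auto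
  finally have "\<beta> ` T = {f} \<times> {..card A * d}" .
  moreover have "inj_on \<beta> T"
    by (rule inj_on_subset[OF bij_betw_imp_inj_on[OF B]]) (auto simp: T_def)
  ultimately have cardT: "card T = Suc (card A * d)"
    by (metis card_cartesian_product_singleton card_image card_atMost)
  have finT: "finite T" using AB(2) by (simp add: T_def)
  have Tcol: "\<phi> b \<in> \<phi> ` A" if "b \<in> T" for b
  proof -
    from that have "b \<in> B" "b \<notin> A" using AB(3) by (auto simp: T_def)
    then have "\<phi> b \<in> fst (\<beta> b) ` A" using bspec[OF \<phi>, of b] by (simp add: complete_bipartite_def)
    also have "fst (\<beta> b) ` A = \<phi> ` A" using that by (simp add: T_def f_def)
    finally show ?thesis .
  qed
  \<comment> \<open>Pigeonhole: \<open>card A * d + 1\<close> vertices share at most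
    \<open>card A\<close> colours.\<close>
  have "\<exists>a\<in>A. d < card {b \<in> T. \<phi> b = \<phi> a}"
  proof (rule ccontr)
    assume "\<not> ?thesis"
    then have le: "card {b \<in> T. \<phi> b = \<phi> a} \<le> d" if "a \<in> A" for a
      using that not_less by blast
    have "T = (\<Union>a\<in>A. {b \<in> T. \<phi> b = \<phi> a})" using Tcol by blast
    then have "card T \<le> (\<Sum>a\<in>A. card {b \<in> T. \<phi> b = \<phi> a})"
      using card_UN_le[OF AB(1), of "\<lambda>a. {b \<in> T. \<phi> b = \<phi> a}"] by simp
    also have "\<dots> \<le> card A * d" using sum_bounded_above[of A, OF le] by simp
    finally show False using cardT by simp
  qed
  then obtain a where a: "a \<in> A" "d < card {b \<in> T. \<phi> b = \<phi> a}" by blast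
  let ?W = "{v \<in> verts ?G. \<phi> v = \<phi> a}" and ?S = "{b \<in> T. \<phi> b = \<phi> a}"
  let ?H = "induced ?G ?W"
  have aV: "a \<in> verts ?G" using a by (simp add: complete_bipartite_def)
  have "?H \<in> max_degree_at_most d" using col aV by (simp add: family_colouring_def)
  moreover have "degree ?H a \<le> max_degree ?H" unfolding max_degree_def
    using aV AB(1,2) by (intro Max_ge) (auto simp: induced_def complete_bipartite_def)
  ultimately have "degree ?H a \<le> d" by (simp add: max_degree_at_most_def)
  \<comment> \<open>Each vertex of \<open>?S\<close> is a neighbour of \<open>a\<close> in its own
    colour class.\<close>
  moreover have "card ?S \<le> degree ?H a"
  proof -
    have "card ?S = card ((\<lambda>b. {a, b}) ` ?S)"
      by (intro card_image[symmetric]) (auto simp: inj_on_def doubleton_eq_iff)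
    also have "\<dots> \<le> degree ?H a" unfolding degree_def
    proof (rule card_mono)
      have "simple_graph ?H"
        using aV by (intro simple_graph_induced simple_complete_bipartite) auto
      from finite_edges[OF this] show "finite {e \<in> edges ?H. a \<in> e}" by (rule finite_subset[rotated]) auto
      show "(\<lambda>b. {a, b}) ` ?S \<subseteq> {e \<in> edges ?H. a \<in> e}"
        using a(1) by (auto simp: induced_def complete_bipartite_def T_def)
    qed
    finally show ?thesis .
  qed
  ultimately show False using a(2) by simp
qed

end

section \<open>Choice of the graphs and comparison of choice numbers\<close>

text \<open>The two sides of the bipartite graph are consecutive intervals of naturals, the second
  as large as the set of labels that \<open>\<beta>\<close> needs. The case \<open>k = 1\<close> is
  included because it occurs below for \<open>p = 0\<close>.\<close>

lemma exists_graph_star_vs_defective: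
  assumes k: "0 < k"
  shows "\<exists>G :: nat sgraph. simple_graph G \<and> family_choice_number star_forests G \<le> k \<and>
           family_choice_number (max_degree_at_most d) G = k * (k + 1)"
proof -
  \<comment> \<open>The largest size of \<open>A\<close> allowed by
    \<open>complete_bipartite_star_choosable\<close>.\<close>
  define n where "n = k * (k + 1) - 1"
  have n: "Suc n = k * (k + 1)" using k by (simp add: n_def)
  define A where "A = {..<n}"
  \<comment> \<open>Consecutive blocks of \<open>n\<close> numbers, hence disjoint lists of size
    \<open>n\<close>.\<close>
  define K where "K a = {a * n..<Suc a * n}" for a
  define T where "T = (\<Pi>\<^sub>E a\<in>A. K a) \<times> {..n * d}"
  define B where "B = {n..<n + card T}"
  have "finite T" by (auto simp: T_def A_def K_def intro!: finite_PiE)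
  then obtain \<beta> where \<beta>: "bij_betw \<beta> B T"
    using finite_same_card_bij[of B T] by (auto simp: B_def)
  have "K a \<inter> K b = {}" if "a < b" for a b
  proof -
    have "Suc a * n \<le> b * n" using that by (intro mult_le_mono1) simp
    then show ?thesis by (auto simp: K_def)
  qed
  then have disj: "disjoint_family_on K A"
    unfolding disjoint_family_on_def by (metis Int_commute linorder_neqE_nat)
  have "n > 0" using n k by (cases "k = 1") (auto simp: n_def)
  then have AB: "finite A" "finite B" "A \<inter> B = {}" "A \<union> B \<noteq> {}" by (auto simp: A_def B_def)
  have cA: "card A = n" by (simp add: A_def)
  let ?G = "complete_bipartite A B" and ?D = "max_degree_at_most d"
  have "family_choice_number star_forests ?G \<le> k"
    unfolding family_choice_number_def
    using complete_bipartite_star_choosable[OF AB k] cA k n by (intro Least_le) auto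
  moreover have "family_choice_number ?D ?G = Suc n"
    unfolding family_choice_number_def
  proof (rule Least_equality)
    show "0 < Suc n \<and> family_choosable ?D (Suc n) ?G"
      using complete_bipartite_choosable[OF AB] cA by simp
    have "\<not> family_choosable ?D n ?G"
      using complete_bipartite_not_choosable[OF AB, of K \<beta> d] disj \<beta> cA by (simp add: K_def T_def)
    then show "Suc n \<le> m" if "0 < m \<and> family_choosable ?D m ?G" for m
      using family_choosable_mono[of ?D m ?G n] that by (meson not_less_eq_eq)
  qed
  ultimately show ?thesis using simple_complete_bipartite[OF AB] n by metis
qed

text \<open>Supplies a graph on which the choice numbers for different families coincide.\<close>

lemma family_choice_number_singleton:
  assumes "star_forests \<subseteq> \<G>"
  shows "family_choice_number \<G> \<lparr>verts = {v}, edges = {}\<rparr> = 1"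
proof -
  let ?G = "\<lparr>verts = {v}, edges = {}\<rparr>"
  have "simple_graph ?G" by (auto simp: simple_graph_def)
  from family_choosable_card(2)[OF this, of \<G>]
  have "family_choosable \<G> 1 ?G" using subsetD[OF assms star_forests_singleton] by simp
  then show ?thesis unfolding family_choice_number_def
    by (intro Least_equality) auto
qed

theorem theorem2p3:
  shows "(\<forall>k d :: nat. 2 \<le> k \<longrightarrow>
            (\<exists>G :: nat sgraph. simple_graph G \<and>
               family_choice_number star_forests G \<le> k \<and>
               family_choice_number (max_degree_at_most d) G = k * (k + 1)))
       \<and> (\<forall>p :: real. \<exists>G :: nat sgraph. simple_graph G \<and>
            real (choice_number G) \<ge> p * real (family_choice_number star_forests G) \<and>
            p * real (family_choice_number star_forests G)
              \<ge> p * real (family_choice_number forests G) \<and>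
            p * real (family_choice_number forests G)
              \<ge> p * real (family_choice_number (mad_at_most 2) G))"
proof (intro conjI allI impI)
  fix k d :: nat assume "2 \<le> k"
  then show "\<exists>G :: nat sgraph. simple_graph G \<and> family_choice_number star_forests G \<le> k \<and>
      family_choice_number (max_degree_at_most d) G = k * (k + 1)"
    by (intro exists_graph_star_vs_defective) simp
next
  fix p :: real
  let ?P = "\<lambda>G :: nat sgraph. simple_graph G \<and>
            real (choice_number G) \<ge> p * real (family_choice_number star_forests G) \<and>
            p * real (family_choice_number star_forests G)
              \<ge> p * real (family_choice_number forests G) \<and>
            p * real (family_choice_number forests G)
              \<ge> p * real (family_choice_number (mad_at_most 2) G)"
  show "\<exists>G. ?P G"
  proof (cases "p < 0")
    \<comment> \<open>A negative factor reverses the inequalities between the choice numbers, so these must all be equal.\<close>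
    case True
    let ?G = "\<lparr>verts = {0 :: nat}, edges = {}\<rparr>"
    have "star_forests \<subseteq> (mad_at_most 2 :: nat sgraph set)"
      using star_forests_subset_forests forests_subset_mad_2 by blast
    note one = family_choice_number_singleton[OF this, of 0]
      family_choice_number_singleton[OF star_forests_subset_forests, of "0 :: nat"]
      family_choice_number_singleton[OF subset_refl, of "0 :: nat"]
    have "?P ?G"
      unfolding one using True by (auto simp: simple_graph_def)
    then show ?thesis by blast
  next
    case False
    \<comment> \<open>The two choice numbers differ by a factor of at least
      \<open>k * (k + 1) / k = k + 1\<close>, which must reach \<open>p\<close>; \<open>Suc\<close>
      keeps \<open>k\<close> positive.\<close>
    define k where "k = Suc (nat \<lceil>p\<rceil>)"
    have pk: "p \<le> real (k + 1)" unfolding k_def by linarith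
    have "0 < k" by (simp add: k_def)
    then obtain G :: "nat sgraph" where G: "simple_graph G"
      "family_choice_number star_forests G \<le> k"
      "family_choice_number (max_degree_at_most 0) G = k * (k + 1)"
      using exists_graph_star_vs_defective by blast
    have "p * real (family_choice_number star_forests G) \<le> real (k + 1) * real k"
      using pk G(2) False by (intro mult_mono) auto
    also have "\<dots> = real (choice_number G)" using G(3) by (simp add: choice_number_eq[OF G(1)] algebra_simps)
    finally have "?P G"
      using G(1) False family_choice_number_antimono[OF G(1) subset_refl star_forests_subset_forests]
        family_choice_number_antimono[OF G(1) star_forests_subset_forests forests_subset_mad_2]
      by (auto intro!: mult_left_mono)
    then show ?thesis by blast
  qed
qed

end
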